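(* There are sequences of polynomials $r_0(x),r_1(x),\ldots$ and $s_0(x),s_1(x),\ldots$ such that for all $k\ge0$, $$C_{2n}^{=n-1+k}=r_k(n)\,(2n-2)!!\quad\text{for all } n\ge k+1,$$ and $$D_{2n+1}^{=n+k}=s_k(n)\,(2n-1)!!\quad\text{for all } n\ge k+1.$$
   Context: For $\sigma=\sigma_1\ldots\sigma_n\in S_n$, let $\mathrm{mmp}^{(1,0,0,0)}(\sigma)$ be the number of indices $i$ such that there exists $j>i$ with $\sigma_j>\sigma_i$. $DU_n$ is the set of down-up permutations in $S_n$ ($\sigma_1>\sigma_2<\sigma_3>\sigma_4<\cdots$). $C_{2n}^{=m}$ denotes the number of $\sigma\in DU_{2n}$ with $\mathrm{mmp}^{(1,0,0,0)}(\sigma)=m$, and $D_{2n+1}^{=m}$ the number of $\sigma\in DU_{2n+1}$ with $\mathrm{mmp}^{(1,0,0,0)}(\sigma)=m$. $(2n)!!=\prod_{i=1}^n(2i)$, $(2n-1)!!=\prod_{i=1}^n(2i-1)$ for $n\ge1$, and $0!!=1$. *)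

theory Defs
  imports
    "HOL-Combinatorics.Permutations"
    "HOL-Computational_Algebra.Polynomial"
begin

text \<open>
  Elements of \<open>S\<^sub>n\<close> are functions \<open>\<sigma>\<close> with \<open>\<sigma> permutes {1..n}\<close>; the one-line notation
  of \<open>\<sigma>\<close> is \<open>\<sigma> 1, \<dots>, \<sigma> n\<close>, so positions and values both start at 1.
\<close>

definition mmp1000 :: "nat \<Rightarrow> (nat \<Rightarrow> nat) \<Rightarrow> nat" where
  "mmp1000 n \<sigma> = card {i \<in> {1..n}. \<exists>j \<in> {1..n}. i < j \<and> \<sigma> i < \<sigma> j}"

definition DU :: "nat \<Rightarrow> (nat \<Rightarrow> nat) set" where
  "DU n = {\<sigma>. \<sigma> permutes {1..n} \<and>
     (\<forall>i \<in> {1..<n}. if odd i then \<sigma> i > \<sigma> (i + 1) else \<sigma> i < \<sigma> (i + 1))}"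

text \<open>The number of down-up permutations of length \<open>N\<close> with statistic \<open>m\<close>. It is written
  \<open>C\<close> for even and \<open>D\<close> for odd length, with subscript \<open>N\<close> and superscript \<open>= m\<close>.\<close>

definition DU_count :: "nat \<Rightarrow> nat \<Rightarrow> nat" where
  "DU_count N m = card {\<sigma> \<in> DU N. mmp1000 N \<sigma> = m}"

abbreviation C_eq :: "nat \<Rightarrow> nat \<Rightarrow> nat" where
  "C_eq n m \<equiv> DU_count (2 * n) m"

abbreviation D_eq :: "nat \<Rightarrow> nat \<Rightarrow> nat" where
  "D_eq n m \<equiv> DU_count (2 * n + 1) m"

definition double_fact :: "nat \<Rightarrow> nat" where
  "double_fact m =
     (if even m then \<Prod>i = 1..m div 2. 2 * i else \<Prod>i = 1..(m + 1) div 2. 2 * i - 1)"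

end

theory Submission
  imports Defs "HOL-Combinatorics.Multiset_Permutations"
begin

text \<open>
  The maximum of an alternating permutation splits it into two alternating permutations, the right
  one starting with an ascent. Every entry left of the maximum contributes to the statistic, the
  maximum does not, and the right part contributes its own statistic. Let \<open>F n m\<close> count the
  permutations of length \<open>n\<close> that start with an ascent and have statistic \<open>m\<close>, so that \<open>F n m = 0\<close>
  for \<open>m < n div 2\<close>. For \<open>e \<in> {0, 1}\<close> put \<open>a k n = F (2 n + e) (n + k) / (2 n + e - 1)!!\<close>.
  Splitting at the maximum gives \<open>a k (n + 1) - a k n = \<Sum>j=1..k. q j n * a (k - j) (n - j)\<close> for
  \<open>n \<ge> k\<close>, with polynomials \<open>q j\<close>: the quotients of a binomial coefficient by double factorials
  cancel to a product of \<open>j\<close> linear factors. By induction on \<open>k\<close>, \<open>a k n\<close> is a polynomial in \<open>n\<close>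
  for \<open>n \<ge> k\<close>. A down-up permutation splits at its maximum into such pieces as well,
  with \<open>e = 1\<close> for even and \<open>e = 0\<close> for odd length.
\<close>

subsection \<open>Alternating lists\<close>

fun alternating :: "bool \<Rightarrow> nat list \<Rightarrow> bool" where
  "alternating d (x # y # xs) \<longleftrightarrow> (if d then x > y else x < y) \<and> alternating (\<not> d) (y # xs)"
| "alternating d xs \<longleftrightarrow> True"

fun dominated :: "nat list \<Rightarrow> nat" where
  "dominated [] = 0"
| "dominated (x # xs) = of_bool (\<exists>y \<in> set xs. x < y) + dominated xs"

lemma alternating_True_Cons_greater:
  "\<forall>z \<in> set zs. z < M \<Longrightarrow> alternating True (M # zs) \<longleftrightarrow> alternating False zs"
  by (cases zs) auto

text \<open>Nothing exceeds \<open>M\<close>, so the step into \<open>M\<close> must be an ascent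
  and the step out of it a descent. With \<open>d\<close> true the peaks sit after an even number of
  entries, otherwise after an odd number. Only the singleton list has no step at \<open>M\<close>
  and escapes this parity condition.\<close>

lemma alternating_split_Max:
  assumes "\<forall>y \<in> set ys. y < M" "\<forall>z \<in> set zs. z < M"
  shows "alternating d (ys @ M # zs) \<longleftrightarrow> alternating d ys \<and> alternating False zs \<and>
    (even (length ys) = d \<or> ys = [] \<and> zs = [])"
  using assms
proof (induction d ys rule: alternating.induct)
  case (1 d x y xs)
  then show ?case by auto
next
  case ("2_1" d)
  then show ?case
    by (cases d; cases zs) (auto simp: alternating_True_Cons_greater)
next
  case ("2_2" d x)
  then show ?case
    by (cases d) (auto simp: alternating_True_Cons_greater)
qed

lemma dominated_split_Max:
  assumes "\<forall>y \<in> set ys. y < M" "\<forall>z \<in> set zs. z < M"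
  shows "dominated (ys @ M # zs) = length ys + dominated zs"
  using assms by (induction ys) auto

lemma alternating_TrueD: "alternating True (y # xs) \<Longrightarrow> alternating False xs"
  by (cases xs) auto

text \<open>Group the entries into consecutive pairs from the left. The first entry of each pair is
  followed at once by a larger one, so every pair contributes at least 1. The induction removes one
  pair at a time.\<close>

lemma dominated_ge: "alternating False xs \<Longrightarrow> length xs div 2 \<le> dominated xs"
proof (induction xs rule: length_induct)
  case (1 xs)
  show ?case
  proof (cases xs)
    case (Cons x ys)
    then show ?thesis
    proof (cases ys)
      case (Cons y zs)
      then have *: "x < y" "alternating False zs"
        using 1(2) \<open>xs = x # ys\<close> alternating_TrueD by auto
      then have "length zs div 2 \<le> dominated zs"
        using 1(1) Cons \<open>xs = x # ys\<close> by auto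
      then show ?thesis using Cons \<open>xs = x # ys\<close> * by auto
    qed auto
  qed auto
qed

section \<open>Relabelling the entries by an increasing map\<close>

lemma alternating_map:
  assumes "strict_mono_on (set xs) f"
  shows "alternating d (map f xs) \<longleftrightarrow> alternating d xs"
  using assms
proof (induction d xs rule: alternating.induct)
  case (1 d x y xs)
  have "strict_mono_on (set (y # xs)) f"
    using 1(2) by (auto simp: strict_mono_on_def)
  moreover have "f x < f y \<longleftrightarrow> x < y" "f y < f x \<longleftrightarrow> y < x"
    using 1(2) by (auto simp: strict_mono_on_less)
  ultimately show ?case using 1(1) by auto
qed auto

lemma dominated_map:
  assumes "strict_mono_on (set xs) f"
  shows "dominated (map f xs) = dominated xs"
  using assms
proof (induction xs)
  case (Cons x xs)
  have "strict_mono_on (set xs) f"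
    using Cons(2) by (auto simp: strict_mono_on_def)
  moreover have "f x < f y \<longleftrightarrow> x < y" if "y \<in> set xs" for y
    using Cons(2) that by (auto simp: strict_mono_on_less)
  ultimately show ?case using Cons(1) by auto
qed auto

definition alt_lists :: "bool \<Rightarrow> nat set \<Rightarrow> nat list set" where
  "alt_lists d S = {xs \<in> permutations_of_set S. alternating d xs}"

definition alt_lists_dom :: "bool \<Rightarrow> nat set \<Rightarrow> nat \<Rightarrow> nat list set" where
  "alt_lists_dom d S m = {xs \<in> alt_lists d S. dominated xs = m}"

definition alt_count :: "bool \<Rightarrow> nat \<Rightarrow> nat" where
  "alt_count d n = card (alt_lists d {1..n})"

definition alt_dom_count :: "bool \<Rightarrow> nat \<Rightarrow> nat \<Rightarrow> nat" where
  "alt_dom_count d n m = card (alt_lists_dom d {1..n} m)"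

lemma finite_alt_lists [simp]: "finite S \<Longrightarrow> finite (alt_lists d S)"
  by (simp add: alt_lists_def)

lemma finite_alt_lists_dom [simp]: "finite S \<Longrightarrow> finite (alt_lists_dom d S m)"
  by (simp add: alt_lists_dom_def)

lemma ex_strict_mono_on_interval:
  assumes "finite (S :: nat set)"
  shows "\<exists>f. strict_mono_on S f \<and> f ` S = {1..card S}"
proof -
  define f where "f x = card {y \<in> S. y \<le> x}" for x
  have sm: "strict_mono_on S f"
  proof (rule strict_mono_onI)
    fix x y assume "x \<in> S" "y \<in> S" "x < y"
    then have "y \<in> {z \<in> S. z \<le> y} - {z \<in> S. z \<le> x}" "{z \<in> S. z \<le> x} \<subseteq> {z \<in> S. z \<le> y}"
      by auto
    then show "f x < f y"
      unfolding f_def using assms by (intro psubset_card_mono) auto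
  qed
  have "f x \<in> {1..card S}" if "x \<in> S" for x
  proof -
    have "{y \<in> S. y \<le> x} \<noteq> {}" using that by auto
    then show ?thesis
      unfolding f_def using assms by (auto simp: card_gt_0_iff Suc_le_eq intro!: card_mono)
  qed
  moreover have "card (f ` S) = card S"
    using sm by (simp add: card_image strict_mono_on_imp_inj_on)
  ultimately have "f ` S = {1..card S}"
    by (intro card_subset_eq) auto
  with sm show ?thesis by blast
qed

lemma permutations_of_set_image:
  assumes "inj_on f S"
  shows "permutations_of_set (f ` S) = map f ` permutations_of_set S"
proof (intro equalityI subsetI)
  fix xs assume xs: "xs \<in> permutations_of_set (f ` S)"
  let ?ys = "map (inv_into S f) xs"
  have 1: "map f ?ys = xs"
    using xs by (auto simp: permutations_of_set_def f_inv_into_f intro!: map_idI)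
  have "set ?ys = S"
    using xs assms by (auto simp: permutations_of_set_def image_image inv_into_f_f)
  moreover have "distinct ?ys"
    using xs 1 by (metis distinct_map permutations_of_setD(2))
  ultimately show "xs \<in> map f ` permutations_of_set S"
    using 1 by (metis imageI permutations_of_setI)
qed (use assms in \<open>auto simp: permutations_of_set_def distinct_map\<close>)

text \<open>The two sides of a maximum have arbitrary value sets. Replacing each entry by its rank
  keeps the alternation and the statistic, so only the size of the value set matters.\<close>

lemma
  assumes "finite S"
  shows card_alt_lists: "card (alt_lists d S) = alt_count d (card S)"
    and card_alt_lists_dom: "card (alt_lists_dom d S m) = alt_dom_count d (card S) m"
proof -
  obtain f where f: "strict_mono_on S f" "f ` S = {1..card S}"
    using ex_strict_mono_on_interval[OF assms] by blast
  have inj: "inj_on f S" using f(1) by (rule strict_mono_on_imp_inj_on)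
  have injm: "inj_on (map f) (permutations_of_set S)"
    using inj by (intro inj_on_mapI) (auto intro: inj_on_subset simp: permutations_of_set_def)
  have perms: "permutations_of_set {1..card S} = map f ` permutations_of_set S"
    using permutations_of_set_image[OF inj] f(2) by simp
  have inv: "alternating d (map f xs) = alternating d xs" "dominated (map f xs) = dominated xs"
    if "xs \<in> permutations_of_set S" for xs
    using f(1) that by (simp_all add: alternating_map dominated_map permutations_of_setD)
  have "alt_lists d {1..card S} = map f ` alt_lists d S"
    unfolding alt_lists_def perms using inv by auto
  moreover have "inj_on (map f) (alt_lists d S)"
    by (rule inj_on_subset[OF injm]) (auto simp: alt_lists_def)
  ultimately show "card (alt_lists d S) = alt_count d (card S)"
    by (simp add: alt_count_def card_image)
  have "alt_lists_dom d {1..card S} m = map f ` alt_lists_dom d S m"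
    unfolding alt_lists_dom_def alt_lists_def perms using inv by auto
  moreover have "inj_on (map f) (alt_lists_dom d S m)"
    by (rule inj_on_subset[OF injm]) (auto simp: alt_lists_def alt_lists_dom_def)
  ultimately show "card (alt_lists_dom d S m) = alt_dom_count d (card S) m"
    by (simp add: alt_dom_count_def card_image)
qed

subsection \<open>Splitting at the maximum\<close>

text \<open>\<open>T\<close> is the set of entries to the left of \<open>M\<close>. All of them
  contribute because of \<open>M\<close>, so the statistic of the left list itself is unrestricted
  and the right list must supply the other \<open>m - card T\<close>. The condition
  \<open>card T \<le> m\<close> keeps this subtraction from being truncated; the parity condition is
  that of \<open>alternating_split_Max\<close>.\<close>

lemma card_alt_lists_dom_insert_Max:
  assumes "finite S" and less: "\<forall>x \<in> S. x < M"
  shows "card (alt_lists_dom d (insert M S) m) =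
    (\<Sum>T \<in> {T. T \<subseteq> S \<and> card T \<le> m \<and> (even (card T) = d \<or> S = {})}.
       card (alt_lists d T) * card (alt_lists_dom False (S - T) (m - card T)))"
proof -
  let ?I = "{T. T \<subseteq> S \<and> card T \<le> m \<and> (even (card T) = d \<or> S = {})}"
  let ?X = "\<lambda>T. alt_lists d T \<times> alt_lists_dom False (S - T) (m - card T)"
  let ?h = "\<lambda>(T :: nat set, ys, zs). ys @ M # zs"
  have M: "M \<notin> S" using less by auto
  have fin: "finite ?I" using assms(1) by simp
  have "bij_betw ?h (Sigma ?I ?X) (alt_lists_dom d (insert M S) m)"
  proof (rule bij_betw_imageI)
    show "inj_on ?h (Sigma ?I ?X)"
    proof (rule inj_onI)
      fix a b assume ab: "a \<in> Sigma ?I ?X" "b \<in> Sigma ?I ?X" "?h a = ?h b"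
      obtain T ys zs T' ys' zs' where eq: "a = (T, ys, zs)" "b = (T', ys', zs')"
        by (metis prod_cases3)
      have "set ys = T" "set ys' = T'" "set zs = S - T" "T \<subseteq> S" "T' \<subseteq> S"
        using ab(1,2) by (simp_all add: eq alt_lists_def alt_lists_dom_def permutations_of_set_def)
      \<comment> \<open>\<open>M\<close> occurs only once in the list, so its place determines the
        two sides.\<close>
      moreover from this have "ys = ys' \<and> zs = zs'"
        using ab(3) M append_Cons_eq_iff[of M ys zs ys' zs'] by (auto simp: eq)
      ultimately show "a = b" by (simp add: eq)
    qed
  next
    show "?h ` Sigma ?I ?X = alt_lists_dom d (insert M S) m"
    proof (intro equalityI subsetI)
      fix xs assume "xs \<in> ?h ` Sigma ?I ?X"
      then obtain T ys zs where T: "T \<in> ?I" and ys: "ys \<in> alt_lists d T"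
        and zs: "zs \<in> alt_lists_dom False (S - T) (m - card T)" and xs: "xs = ys @ M # zs"
        by auto
      have sets: "set ys = T" "set zs = S - T" "distinct ys" "distinct zs"
        using ys zs by (auto simp: alt_lists_def alt_lists_dom_def permutations_of_set_def)
      then have len: "length ys = card T" using distinct_card by force
      have lt: "\<forall>y \<in> set ys. y < M" "\<forall>z \<in> set zs. z < M" using sets T less by auto
      have "S = {} \<Longrightarrow> ys = [] \<and> zs = []" using sets T by auto
      then show "xs \<in> alt_lists_dom d (insert M S) m"
        using ys zs T sets M len
        by (auto simp: xs alt_lists_dom_def alt_lists_def permutations_of_set_def
            alternating_split_Max[OF lt] dominated_split_Max[OF lt])
    next
      fix xs assume xs: "xs \<in> alt_lists_dom d (insert M S) m"
      then have p: "set xs = insert M S" "distinct xs" "alternating d xs" "dominated xs = m"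
        by (auto simp: alt_lists_dom_def alt_lists_def permutations_of_set_def)
      obtain ys zs where split: "xs = ys @ M # zs"
        using p(1) by (metis insertI1 split_list)
      have un: "set ys \<union> set zs = S" "set ys \<inter> set zs = {}" "distinct ys" "distinct zs"
        using p M split by auto
      have lt: "\<forall>y \<in> set ys. y < M" "\<forall>z \<in> set zs. z < M" using un less by auto
      have len: "length ys = card (set ys)" using un by (simp add: distinct_card)
      have "alternating d ys" "alternating False zs" "even (length ys) = d \<or> ys = [] \<and> zs = []"
        "length ys + dominated zs = m"
        using p(3,4) by (auto simp: split alternating_split_Max[OF lt] dominated_split_Max[OF lt])
      moreover have "S - set ys = set zs" using un by auto
      ultimately have "(set ys, ys, zs) \<in> Sigma ?I ?X"
        using un len
        by (auto simp: alt_lists_dom_def alt_lists_def permutations_of_set_def)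
      then show "xs \<in> ?h ` Sigma ?I ?X" by (rule image_eqI[rotated]) (simp add: split)
    qed
  qed
  then have "card (alt_lists_dom d (insert M S) m) = card (Sigma ?I ?X)"
    by (simp add: bij_betw_same_card)
  also have "\<dots> = (\<Sum>T \<in> ?I. card (?X T))"
    using fin assms(1) by (intro card_SigmaI) (auto dest: finite_subset)
  finally show ?thesis by (simp add: card_cartesian_product)
qed

text \<open>The summand for a left set \<open>T\<close> depends on \<open>card T\<close> alone, so
  grouping the sets by their size \<open>p\<close> produces the binomial coefficient.\<close>

lemma alt_dom_count_Suc:
  "alt_dom_count d (Suc N) m =
    (\<Sum>p \<in> {p. p \<le> N \<and> p \<le> m \<and> (even p = d \<or> N = 0)}.
       (N choose p) * alt_count d p * alt_dom_count False (N - p) (m - p))"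
proof -
  let ?S = "{1..N}"
  let ?I = "{T. T \<subseteq> ?S \<and> card T \<le> m \<and> (even (card T) = d \<or> ?S = {})}"
  let ?J = "{p. p \<le> N \<and> p \<le> m \<and> (even p = d \<or> N = 0)}"
  let ?g = "\<lambda>p. alt_count d p * alt_dom_count False (N - p) (m - p)"
  have "{1..Suc N} = insert (Suc N) ?S" by auto
  then have "alt_dom_count d (Suc N) m = (\<Sum>T \<in> ?I.
      card (alt_lists d T) * card (alt_lists_dom False (?S - T) (m - card T)))"
    unfolding alt_dom_count_def
    using card_alt_lists_dom_insert_Max[of ?S "Suc N" d m] by simp
  also have "\<dots> = (\<Sum>T \<in> ?I. ?g (card T))"
  proof (rule sum.cong[OF refl])
    fix T assume T: "T \<in> ?I"
    then have fT: "finite T" using finite_subset by blast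
    show "card (alt_lists d T) * card (alt_lists_dom False (?S - T) (m - card T)) = ?g (card T)"
      using T fT by (simp add: card_alt_lists card_alt_lists_dom card_Diff_subset)
  qed
  also have "\<dots> = (\<Sum>p \<in> ?J. \<Sum>T \<in> {T \<in> ?I. card T = p}. ?g (card T))"
  proof (rule sum.group[symmetric])
    show "card ` ?I \<subseteq> ?J"
      using card_mono[of ?S] by auto
  qed auto
  also have "\<dots> = (\<Sum>p \<in> ?J. (N choose p) * ?g p)"
  proof (rule sum.cong[OF refl])
    fix p assume "p \<in> ?J"
    then have "{T \<in> ?I. card T = p} = {T. T \<subseteq> ?S \<and> card T = p}" by auto
    then show "(\<Sum>T \<in> {T \<in> ?I. card T = p}. ?g (card T)) = (N choose p) * ?g p"
      using n_subsets[of ?S p] by simp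
  qed
  finally show ?thesis by (simp add: mult.assoc)
qed

lemma alt_dom_count_eq_0:
  assumes "m < n div 2"
  shows "alt_dom_count False n m = 0"
proof -
  have "alt_lists_dom False {1..n} m = {}"
  proof (rule ccontr)
    assume "alt_lists_dom False {1..n} m \<noteq> {}"
    then obtain xs where xs: "set xs = {1..n}" "distinct xs" "alternating False xs" "dominated xs = m"
      by (auto simp: alt_lists_dom_def alt_lists_def permutations_of_set_def)
    then have "length xs = n" using distinct_card[of xs] by simp
    with dominated_ge[OF xs(3)] xs(4) assms show False by simp
  qed
  then show ?thesis by (simp add: alt_dom_count_def)
qed

section \<open>Recurrences in terms of the excess over half the length\<close>

text \<open>The left block has odd length \<open>p = 2 * j + 1\<close>. Removing it and the maximum
  lowers the excess of the statistic over half the length from \<open>k\<close> to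
  \<open>k - j\<close>. For \<open>j > k\<close> the right block would have too small a statistic,
  so the sum stops at \<open>k\<close>; \<open>k \<le> n\<close> ensures that all these block
  lengths occur.\<close>

lemma alt_dom_count_False_rec:
  assumes "k \<le> n" "e \<le> 1"
  shows "alt_dom_count False (2 * Suc n + e) (Suc n + k) =
    (\<Sum>j\<le>k. ((2 * n + e + 1) choose (2 * j + 1)) * alt_count False (2 * j + 1) *
       alt_dom_count False (2 * (n - j) + e) ((n - j) + (k - j)))"
proof -
  let ?N = "2 * n + e + 1" and ?m = "Suc n + k"
  let ?J = "{p. p \<le> ?N \<and> p \<le> ?m \<and> (even p = False \<or> ?N = 0)}"
  let ?f = "\<lambda>p. (?N choose p) * alt_count False p * alt_dom_count False (?N - p) (?m - p)"
  have "alt_dom_count False (2 * Suc n + e) ?m = sum ?f ?J"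
    using alt_dom_count_Suc[of False ?N ?m] by simp
  also have "\<dots> = sum ?f ((\<lambda>j. 2 * j + 1) ` {..k})"
  proof (rule sum.mono_neutral_right)
    show "\<forall>p \<in> ?J - (\<lambda>j. 2 * j + 1) ` {..k}. ?f p = 0"
    proof
      fix p assume p: "p \<in> ?J - (\<lambda>j. 2 * j + 1) ` {..k}"
      then obtain j where j: "p = 2 * j + 1" by (auto elim: oddE)
      then have "k < j" using p by force
      then have "?m - p < (?N - p) div 2" using p j by auto
      then show "?f p = 0" by (simp add: alt_dom_count_eq_0)
    qed
  qed (use assms in auto)
  also have "\<dots> = (\<Sum>j\<le>k. ?f (2 * j + 1))"
    by (subst sum.reindex) (auto simp: inj_on_def)
  also have "\<dots> = (\<Sum>j\<le>k. (?N choose (2 * j + 1)) * alt_count False (2 * j + 1) *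
       alt_dom_count False (2 * (n - j) + e) ((n - j) + (k - j)))"
  proof (rule sum.cong[OF refl])
    fix j assume "j \<in> {..k}"
    then have "?N - (2 * j + 1) = 2 * (n - j) + e" "?m - (2 * j + 1) = (n - j) + (k - j)"
      using assms by auto
    then show "?f (2 * j + 1) = (?N choose (2 * j + 1)) * alt_count False (2 * j + 1) *
       alt_dom_count False (2 * (n - j) + e) ((n - j) + (k - j))" by simp
  qed
  finally show ?thesis .
qed

text \<open>As before, but the initial descent makes the left block even, \<open>p = 2 * j\<close>.
  Only counts with an initial ascent appear on the right, so this expresses one family by the other
  instead of being recursive.\<close>

lemma alt_dom_count_True_rec:
  assumes "k \<le> n" "e \<le> 1"
  shows "alt_dom_count True (2 * n + e + 1) (n + k) =
    (\<Sum>j\<le>k. ((2 * n + e) choose (2 * j)) * alt_count True (2 * j) *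
       alt_dom_count False (2 * (n - j) + e) ((n - j) + (k - j)))"
proof -
  let ?N = "2 * n + e" and ?m = "n + k"
  let ?J = "{p. p \<le> ?N \<and> p \<le> ?m \<and> (even p = True \<or> ?N = 0)}"
  let ?f = "\<lambda>p. (?N choose p) * alt_count True p * alt_dom_count False (?N - p) (?m - p)"
  have "alt_dom_count True (2 * n + e + 1) ?m = sum ?f ?J"
    using alt_dom_count_Suc[of True ?N ?m] by simp
  also have "\<dots> = sum ?f ((\<lambda>j. 2 * j) ` {..k})"
  proof (rule sum.mono_neutral_right)
    show "\<forall>p \<in> ?J - (\<lambda>j. 2 * j) ` {..k}. ?f p = 0"
    proof
      fix p assume p: "p \<in> ?J - (\<lambda>j. 2 * j) ` {..k}"
      then obtain j where j: "p = 2 * j" by (auto elim: evenE)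
      then have "k < j" using p by force
      then have "?m - p < (?N - p) div 2" using p j by auto
      then show "?f p = 0" by (simp add: alt_dom_count_eq_0)
    qed
  qed (use assms in auto)
  also have "\<dots> = (\<Sum>j\<le>k. ?f (2 * j))"
    by (subst sum.reindex) (auto simp: inj_on_def)
  also have "\<dots> = (\<Sum>j\<le>k. (?N choose (2 * j)) * alt_count True (2 * j) *
       alt_dom_count False (2 * (n - j) + e) ((n - j) + (k - j)))"
  proof (rule sum.cong[OF refl])
    fix j assume "j \<in> {..k}"
    then have "?N - 2 * j = 2 * (n - j) + e" "?m - 2 * j = (n - j) + (k - j)"
      using assms by auto
    then show "?f (2 * j) = (?N choose (2 * j)) * alt_count True (2 * j) *
       alt_dom_count False (2 * (n - j) + e) ((n - j) + (k - j))" by simp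
  qed
  finally show ?thesis .
qed

subsection \<open>Polynomiality\<close>

text \<open>By the binomial theorem the difference of \<open>x ^ Suc d\<close> is
  \<open>of_nat (Suc d) * x ^ d\<close> plus a combination of lower powers. The induction hypothesis
  gives antidifferences for the latter; subtracting them and dividing by \<open>Suc d\<close> yields
  the witness \<open>Q\<close>.\<close>

lemma ex_antidifference_power:
  "\<exists>P :: 'a :: field_char_0 poly. \<forall>x. poly P (x + 1) - poly P x = x ^ d"
proof (induction d rule: less_induct)
  case (less d)
  then obtain P :: "nat \<Rightarrow> 'a poly"
    where P: "\<And>i x. i < d \<Longrightarrow> poly (P i) (x + 1) - poly (P i) x = x ^ i"
    by metis
  define Q where "Q = smult (1 / of_nat (Suc d))
    (monom 1 (Suc d) - (\<Sum>i<d. smult (of_nat (Suc d choose i)) (P i)))"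
  have "poly Q (x + 1) - poly Q x = x ^ d" for x
  proof -
    have "(x + 1) ^ Suc d = (\<Sum>i\<le>Suc d. of_nat (Suc d choose i) * x ^ i)"
      by (simp add: binomial_ring del: power_Suc binomial_Suc_Suc)
    also have "\<dots> = (\<Sum>i<d. of_nat (Suc d choose i) * x ^ i) + of_nat (Suc d) * x ^ d + x ^ Suc d"
      by (simp add: lessThan_Suc_atMost[symmetric] del: binomial_Suc_Suc power_Suc)
    finally have "(x + 1) ^ Suc d - x ^ Suc d - (\<Sum>i<d. of_nat (Suc d choose i) * x ^ i)
        = of_nat (Suc d) * x ^ d"
      by (simp del: binomial_Suc_Suc power_Suc)
    moreover have "(\<Sum>i<d. of_nat (Suc d choose i) * x ^ i) =
        (\<Sum>i<d. of_nat (Suc d choose i) * poly (P i) (x + 1)) -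
        (\<Sum>i<d. of_nat (Suc d choose i) * poly (P i) x)"
      unfolding sum_subtractf[symmetric] right_diff_distrib[symmetric]
      by (rule sum.cong) (simp_all add: P del: binomial_Suc_Suc)
    ultimately have "((x + 1) ^ Suc d - (\<Sum>i<d. of_nat (Suc d choose i) * poly (P i) (x + 1))) -
        (x ^ Suc d - (\<Sum>i<d. of_nat (Suc d choose i) * poly (P i) x)) = of_nat (Suc d) * x ^ d"
      by (simp only: algebra_simps)
    then show ?thesis
      unfolding Q_def poly_smult poly_diff poly_monom poly_sum right_diff_distrib[symmetric]
      by (simp del: binomial_Suc_Suc power_Suc of_nat_Suc)
  qed
  then show ?case by blast
qed

lemma ex_antidifference:
  fixes Q :: "'a :: field_char_0 poly"
  shows "\<exists>P. \<forall>x. poly P (x + 1) - poly P x = poly Q x"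
proof -
  obtain P :: "nat \<Rightarrow> 'a poly" where P: "\<And>d x. poly (P d) (x + 1) - poly (P d) x = x ^ d"
    using ex_antidifference_power by metis
  have "poly (\<Sum>i\<le>degree Q. smult (coeff Q i) (P i)) (x + 1) -
      poly (\<Sum>i\<le>degree Q. smult (coeff Q i) (P i)) x = poly Q x" for x
    unfolding poly_altdef[of Q]
    by (simp add: poly_sum sum_subtractf[symmetric] right_diff_distrib[symmetric] P)
  then show ?thesis by blast
qed

section \<open>Cancellation between binomial coefficients and double factorials\<close>

text \<open>\<open>dfact 0 n\<close> is \<open>(2n - 1)!!\<close> and \<open>dfact 1 n\<close> is \<open>(2n)!!\<close>.\<close>

definition dfact :: "nat \<Rightarrow> nat \<Rightarrow> nat" where
  "dfact e n = (\<Prod>i<n. 2 * i + 1 + e)"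

lemma dfact_Suc: "dfact e (Suc n) = dfact e n * (2 * n + 1 + e)"
  by (simp add: dfact_def)

lemma dfact_pos: "dfact e n > 0"
  by (simp add: dfact_def)

text \<open>The numerator of \<open>(2 * n + e) choose (2 * j)\<close> is the product of the factors
  \<open>2 * n + e - i\<close> for \<open>i < 2 * j\<close>. Those with odd \<open>i\<close>
  multiply to \<open>dfact e n / dfact e (n - j)\<close> and cancel; those with even
  \<open>i\<close> remain and form this polynomial in \<open>n\<close>.\<close>

definition ratio_poly :: "nat \<Rightarrow> nat \<Rightarrow> rat poly" where
  "ratio_poly e j = smult (1 / fact (2 * j)) (\<Prod>i<j. [:of_nat e - 2 * of_nat i, 2:])"

lemma poly_ratio_poly:
  "poly (ratio_poly e j) x = (\<Prod>i<j. 2 * x + of_nat e - 2 * of_nat i) / fact (2 * j)"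
  by (simp add: ratio_poly_def poly_prod algebra_simps)

lemma choose_even_dfact:
  assumes "j \<le> n"
  shows "of_nat ((2 * n + e) choose (2 * j)) * of_nat (dfact e (n - j)) =
    poly (ratio_poly e j) (of_nat n) * of_nat (dfact e n)"
  using assms
proof (induction j)
  case 0
  then show ?case by (simp add: ratio_poly_def)
next
  case (Suc j)
  \<comment> \<open>Writing \<open>r\<close> for \<open>n - Suc j\<close> avoids truncated
    subtraction in all factors below.\<close>
  obtain r where n: "n = Suc (j + r)" using Suc.prems less_iff_Suc_add[of j n] by auto
  let ?N = "2 * n + e"
  have absorb: "Suc i * (?N choose Suc i) = (?N - i) * (?N choose i)" for i
    using binomial_absorption[of i ?N] binomial_absorb_comp[of ?N i] by simp
  \<comment> \<open>The lower index grows by 2 in two steps. The factor \<open>2 * r + 2 + e\<close>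
    from the first is the new linear factor of \<open>ratio_poly\<close>; the factor
    \<open>2 * r + 1 + e\<close> from the second turns \<open>dfact e r\<close> into
    \<open>dfact e (Suc r)\<close>.\<close>
  have c1: "of_nat (?N choose Suc (2 * j)) * of_nat (2 * j + 1) =
      (of_nat (?N choose (2 * j)) * of_nat (2 * r + 2 + e) :: rat)"
    using absorb[of "2 * j"] n unfolding of_nat_mult[symmetric] of_nat_eq_iff
    by (simp add: mult.commute del: binomial_Suc_Suc)
  have c2: "of_nat (?N choose Suc (Suc (2 * j))) * of_nat (2 * j + 2) =
      (of_nat (?N choose Suc (2 * j)) * of_nat (2 * r + 1 + e) :: rat)"
    using absorb[of "Suc (2 * j)"] n unfolding of_nat_mult[symmetric] of_nat_eq_iff
    by (simp add: mult.commute del: binomial_Suc_Suc)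
  have IH: "of_nat (?N choose (2 * j)) * of_nat (dfact e (Suc r)) =
    poly (ratio_poly e j) (of_nat n) * of_nat (dfact e n)"
    using Suc n by simp
  have R: "poly (ratio_poly e (Suc j)) (of_nat n) * (of_nat (2 * j + 1) * of_nat (2 * j + 2)) =
     poly (ratio_poly e j) (of_nat n) * of_nat (2 * r + 2 + e)"
  proof -
    have "fact (2 * Suc j) = (of_nat (2 * j + 1) * of_nat (2 * j + 2) * fact (2 * j) :: rat)"
      by (simp add: algebra_simps)
    moreover have "2 * of_nat n + of_nat e - 2 * of_nat j = (of_nat (2 * r + 2 + e) :: rat)"
      by (simp add: n)
    moreover have "of_nat (2 * j + 1) \<noteq> (0 :: rat)" "of_nat (2 * j + 2) \<noteq> (0 :: rat)"
      unfolding of_nat_eq_0_iff by simp_all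
    ultimately show ?thesis
      unfolding poly_ratio_poly prod.lessThan_Suc by (simp del: of_nat_add of_nat_mult)
  qed
  have "(of_nat (?N choose (2 * Suc j)) * of_nat (dfact e r)) *
      (of_nat (2 * j + 1) * of_nat (2 * j + 2) :: rat) =
      (of_nat (?N choose Suc (Suc (2 * j))) * of_nat (2 * j + 2)) * of_nat (2 * j + 1) * of_nat (dfact e r)"
    by simp
  also have "\<dots> = (of_nat (?N choose Suc (2 * j)) * of_nat (2 * j + 1)) *
      (of_nat (2 * r + 1 + e) * of_nat (dfact e r))"
    unfolding c2 by (simp only: ac_simps)
  also have "\<dots> = of_nat (2 * r + 2 + e) * (of_nat (?N choose (2 * j)) * of_nat (dfact e (Suc r)))"
    unfolding c1 dfact_Suc of_nat_mult by (simp only: ac_simps)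
  also have "\<dots> = (poly (ratio_poly e (Suc j)) (of_nat n) * of_nat (dfact e n)) *
      (of_nat (2 * j + 1) * of_nat (2 * j + 2))"
    unfolding IH using R by algebra
  finally have "of_nat (?N choose (2 * Suc j)) * of_nat (dfact e r) =
      poly (ratio_poly e (Suc j)) (of_nat n) * (of_nat (dfact e n) :: rat)"
    by (subst (asm) mult_right_cancel) (simp_all add: of_nat_eq_0_iff del: of_nat_add of_nat_mult)
  then show ?case using n by simp
qed

text \<open>Absorption reduces this to the even case: it splits off
  \<open>(2 * n + e + 1) / (2 * j + 1)\<close>, whose numerator raises \<open>dfact e n\<close> to
  \<open>dfact e (Suc n)\<close>.\<close>

lemma choose_odd_dfact:
  assumes "j \<le> n"
  shows "of_nat ((2 * n + e + 1) choose (2 * j + 1)) * of_nat (dfact e (n - j)) =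
    poly (smult (1 / of_nat (2 * j + 1)) (ratio_poly e j)) (of_nat n) * of_nat (dfact e (Suc n))"
proof -
  have "of_nat (2 * j + 1) * of_nat ((2 * n + e + 1) choose (2 * j + 1)) =
      (of_nat (2 * n + 1 + e) * of_nat ((2 * n + e) choose (2 * j)) :: rat)"
    using Suc_times_binomial_eq[of "2 * n + e" "2 * j"]
    unfolding of_nat_mult[symmetric] by (simp add: mult.commute)
  then have "of_nat ((2 * n + e + 1) choose (2 * j + 1)) =
      (of_nat (2 * n + 1 + e) * of_nat ((2 * n + e) choose (2 * j)) / of_nat (2 * j + 1) :: rat)"
    by (simp add: field_simps del: of_nat_add of_nat_mult)
  then show ?thesis
    using choose_even_dfact[OF assms, of e]
    by (simp add: dfact_Suc mult_ac del: of_nat_add binomial_Suc_Suc mult_Suc_right mult_Suc)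
qed

section \<open>Polynomial formulas for the counts\<close>

lemma alt_dom_count_False_poly:
  assumes "e \<le> 1"
  shows "\<exists>p :: rat poly. \<forall>n \<ge> k. of_nat (alt_dom_count False (2 * n + e) (n + k)) =
    poly p (of_nat n) * of_nat (dfact e n)"
proof (induction k rule: less_induct)
  case (less k)
  let ?F = "\<lambda>n k. alt_dom_count False (2 * n + e) (n + k)"
  obtain p :: "nat \<Rightarrow> rat poly" where p: "\<And>i n. i < k \<Longrightarrow> i \<le> n \<Longrightarrow>
      of_nat (?F n i) = poly (p i) (of_nat n) * of_nat (dfact e n)"
    using less by metis
  define a :: "nat \<Rightarrow> rat" where "a n = of_nat (?F n k) / of_nat (dfact e n)" for n
  \<comment> \<open>This is the difference of \<open>a\<close>: the terms of the recurrence with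
    \<open>j \<ge> 1\<close>, divided by \<open>dfact e (Suc n)\<close>. Composing with
    \<open>[:- of_nat j, 1:]\<close> evaluates the earlier polynomial at
    \<open>n - j\<close>.\<close>
  define Q where "Q = (\<Sum>j\<in>{1..k}. smult (of_nat (alt_count False (2 * j + 1)))
    (smult (1 / of_nat (2 * j + 1)) (ratio_poly e j) * pcompose (p (k - j)) [:- of_nat j, 1:]))"
  have nz: "of_nat (dfact e n) \<noteq> (0 :: rat)" for n using dfact_pos[of e n] by simp
  have step: "a (Suc n) = a n + poly Q (of_nat n)" if n: "k \<le> n" for n
  proof -
    let ?G = "\<lambda>j. of_nat (alt_count False (2 * j + 1)) :: rat"
    have one: "alt_count False 1 = 1"
    proof -
      have "alt_lists False {1..1} = {[1]}"
        by (auto simp: alt_lists_def)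
      then show ?thesis by (simp add: alt_count_def)
    qed
    have "of_nat (?F (Suc n) k) = (\<Sum>j\<le>k. of_nat ((2 * n + e + 1) choose (2 * j + 1)) *
        ?G j * of_nat (?F (n - j) (k - j)))"
      using alt_dom_count_False_rec[OF n assms] by simp
    \<comment> \<open>The term \<open>j = 0\<close> is the only one that still has excess
      \<open>k\<close>. Its coefficient \<open>2 * n + e + 1\<close> is the quotient of
      \<open>dfact e (Suc n)\<close> by \<open>dfact e n\<close>, so after normalisation it becomes
      exactly \<open>a n\<close>.\<close>
    also have "\<dots> = of_nat (2 * n + e + 1) * of_nat (?F n k) +
       (\<Sum>j\<in>{1..k}. of_nat ((2 * n + e + 1) choose (2 * j + 1)) * ?G j * of_nat (?F (n - j) (k - j)))"
      using one
      by (simp add: atMost_atLeast0 sum.atLeast_Suc_atMost)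
    also have "(\<Sum>j\<in>{1..k}. of_nat ((2 * n + e + 1) choose (2 * j + 1)) * ?G j *
        of_nat (?F (n - j) (k - j))) = poly Q (of_nat n) * of_nat (dfact e (Suc n))"
      unfolding Q_def poly_sum sum_distrib_right
    proof (rule sum.cong[OF refl])
      fix j assume j: "j \<in> {1..k}"
      \<comment> \<open>The induction hypothesis applies because \<open>j \<ge> 1\<close> gives
        \<open>k - j < k\<close>, and \<open>k \<le> n\<close> gives
        \<open>k - j \<le> n - j\<close>.\<close>
      have "of_nat (?F (n - j) (k - j)) = poly (p (k - j)) (of_nat (n - j)) * of_nat (dfact e (n - j))"
        using j n by (intro p) auto
      moreover have "poly (pcompose (p (k - j)) [:- of_nat j, 1:]) (of_nat n) =
          poly (p (k - j)) (of_nat (n - j))"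
        using j n by (simp add: poly_pcompose of_nat_diff)
      \<comment> \<open>The premise has the shape of \<open>choose_odd_dfact\<close>, with
        \<open>B\<close> the binomial coefficient and \<open>D\<close>, \<open>N\<close> the two
        double factorials; \<open>g\<close> is the left count and \<open>P\<close> the value of the
        earlier polynomial.\<close>
      moreover have "B * D = Z * N \<Longrightarrow> B * g * (P * D) = g * (Z * P) * N" for B D Z N g P :: rat
        by algebra
      ultimately show "of_nat ((2 * n + e + 1) choose (2 * j + 1)) * ?G j * of_nat (?F (n - j) (k - j))
        = poly (smult (?G j) (smult (1 / of_nat (2 * j + 1)) (ratio_poly e j) *
            pcompose (p (k - j)) [:- of_nat j, 1:])) (of_nat n) * of_nat (dfact e (Suc n))"
        using choose_odd_dfact[of j n e] j n
        by (simp only: poly_smult[of "?G j"] poly_mult atLeastAtMost_iff order_trans[of j k n])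
    qed
    finally have "of_nat (?F (Suc n) k) = of_nat (2 * n + e + 1) * of_nat (?F n k) +
        poly Q (of_nat n) * of_nat (dfact e (Suc n))" .
    moreover have "of_nat (dfact e (Suc n)) = (of_nat (dfact e n) * of_nat (2 * n + e + 1) :: rat)"
      by (simp add: dfact_Suc algebra_simps)
    moreover have "of_nat (2 * n + e + 1) \<noteq> (0 :: rat)"
      unfolding of_nat_eq_0_iff by simp
    ultimately show ?thesis
      unfolding a_def using nz[of n] nz[of "Suc n"]
      by (simp add: add_divide_distrib del: of_nat_add of_nat_mult)
  qed
  obtain P where P: "\<And>x. poly P (x + 1) - poly P x = poly Q x"
    using ex_antidifference by blast
  \<comment> \<open>From \<open>k\<close> on, \<open>a\<close> and \<open>P\<close> have the same
    differences, so they differ by a constant, which is read off at \<open>n = k\<close>.\<close>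
  have "a n = poly (P + [:a k - poly P (of_nat k):]) (of_nat n)" if "k \<le> n" for n
    using that
  proof (induction n rule: dec_induct)
    case (step n)
    then show ?case using P[of "of_nat n"] \<open>k \<le> n\<close> assms
      by (simp add: \<open>\<And>n. k \<le> n \<Longrightarrow> a (Suc n) = a n + poly Q (of_nat n)\<close> add.commute)
  qed simp
  then have "\<forall>n \<ge> k. of_nat (?F n k) =
      poly (P + [:a k - poly P (of_nat k):]) (of_nat n) * of_nat (dfact e n)"
    using nz unfolding a_def by (metis nonzero_divide_eq_eq)
  then show ?case by blast
qed

text \<open>No difference equation has to be solved here: every term on the right of
  \<open>alt_dom_count_True_rec\<close>, including \<open>j = 0\<close>, is already known to be a
  polynomial times a double factorial.\<close>

lemma alt_dom_count_True_poly:
  assumes "e \<le> 1"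
  shows "\<exists>p :: rat poly. \<forall>n \<ge> k. of_nat (alt_dom_count True (2 * n + e + 1) (n + k)) =
    poly p (of_nat n) * of_nat (dfact e n)"
proof -
  obtain p :: "nat \<Rightarrow> rat poly" where p: "\<And>i n. i \<le> n \<Longrightarrow>
      of_nat (alt_dom_count False (2 * n + e) (n + i)) = poly (p i) (of_nat n) * of_nat (dfact e n)"
    using alt_dom_count_False_poly[OF assms] by metis
  let ?F = "\<lambda>n k. alt_dom_count False (2 * n + e) (n + k)"
  let ?G = "\<lambda>j. of_nat (alt_count True (2 * j)) :: rat"
  define Q where "Q = (\<Sum>j\<le>k. smult (?G j) (ratio_poly e j * pcompose (p (k - j)) [:- of_nat j, 1:]))"
  have "of_nat (alt_dom_count True (2 * n + e + 1) (n + k)) = poly Q (of_nat n) * of_nat (dfact e n)"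
    if n: "k \<le> n" for n
  proof -
    have "of_nat (alt_dom_count True (2 * n + e + 1) (n + k)) =
        (\<Sum>j\<le>k. of_nat ((2 * n + e) choose (2 * j)) * ?G j * of_nat (?F (n - j) (k - j)))"
      using alt_dom_count_True_rec[OF n assms] by simp
    also have "\<dots> = poly Q (of_nat n) * of_nat (dfact e n)"
      unfolding Q_def poly_sum sum_distrib_right
    proof (rule sum.cong[OF refl])
      fix j assume j: "j \<in> {..k}"
      have "of_nat (?F (n - j) (k - j)) = poly (p (k - j)) (of_nat (n - j)) * of_nat (dfact e (n - j))"
        using j n by (intro p) auto
      moreover have "of_nat (n - j) = (of_nat n - of_nat j :: rat)" using j n by (simp add: of_nat_diff)
      ultimately show "of_nat ((2 * n + e) choose (2 * j)) * ?G j * of_nat (?F (n - j) (k - j))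
        = poly (smult (?G j) (ratio_poly e j * pcompose (p (k - j)) [:- of_nat j, 1:])) (of_nat n) *
          of_nat (dfact e n)"
        using choose_even_dfact[of j n e] j n
        by (simp add: poly_pcompose mult_ac del: of_nat_add of_nat_mult)
    qed
    finally show ?thesis .
  qed
  then show ?thesis by blast
qed

subsection \<open>Permutations as lists\<close>

text \<open>List indices start at 0 and positions of a permutation at 1, so descents at even indices
  here match descents at odd positions in \<open>DU\<close>.\<close>

lemma alternating_iff_nth:
  "alternating d xs \<longleftrightarrow> (\<forall>i. Suc i < length xs \<longrightarrow>
     (if even i = d then xs ! i > xs ! Suc i else xs ! i < xs ! Suc i))"
proof (induction d xs rule: alternating.induct)
  case (1 d x y xs)
  show ?case (is "_ \<longleftrightarrow> (\<forall>i. ?P i)")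
  proof -
    have "(\<forall>i. Q i) \<longleftrightarrow> Q 0 \<and> (\<forall>i. Q (Suc i))" for Q :: "nat \<Rightarrow> bool"
      by (metis not0_implies_Suc)
    from this[of ?P] have "(\<forall>i. ?P i) \<longleftrightarrow> ?P 0 \<and> (\<forall>i. ?P (Suc i))" .
    moreover have "?P 0 \<longleftrightarrow> (if d then x > y else x < y)"
      by simp
    moreover have "?P (Suc i) \<longleftrightarrow> (Suc i < length (y # xs) \<longrightarrow>
        (if even i = (\<not> d) then (y # xs) ! i > (y # xs) ! Suc i else (y # xs) ! i < (y # xs) ! Suc i))" for i
      by auto
    ultimately show ?thesis using 1 by simp
  qed
qed auto

lemma dominated_eq_sum:
  "dominated xs = (\<Sum>i<length xs. of_bool (\<exists>j<length xs. i < j \<and> xs ! i < xs ! j))"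
proof (induction xs)
  case (Cons x xs)
  have 1: "(\<exists>y \<in> set xs. x < y) \<longleftrightarrow> (\<exists>j<Suc (length xs). 0 < j \<and> x < (x # xs) ! j)"
    by (simp add: Ex_less_Suc2) (metis in_set_conv_nth)
  have 2: "(\<exists>j<length xs. i < j \<and> xs ! i < xs ! j) \<longleftrightarrow>
      (\<exists>j<Suc (length xs). Suc i < j \<and> xs ! i < (x # xs) ! j)" for i
    by (simp add: Ex_less_Suc2)
  show ?case
    by (simp add: sum.lessThan_Suc_shift Cons 1 2 del: sum.lessThan_Suc)
qed simp

lemma bij_betw_permutes_lists:
  "bij_betw (\<lambda>\<sigma>. map \<sigma> [1..<Suc n]) {\<sigma>. \<sigma> permutes {1..n}} (permutations_of_set {1..n})"
proof -
  let ?f = "\<lambda>\<sigma> :: nat \<Rightarrow> nat. map \<sigma> [1..<Suc n]"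
  have inj: "inj_on ?f {\<sigma>. \<sigma> permutes {1..n}}"
  proof (rule inj_onI)
    fix \<sigma> \<tau> assume *: "\<sigma> \<in> {\<sigma>. \<sigma> permutes {1..n}}" "\<tau> \<in> {\<sigma>. \<sigma> permutes {1..n}}"
      "map \<sigma> [1..<Suc n] = map \<tau> [1..<Suc n]"
    have "\<sigma> i = \<tau> i" if "i \<in> {1..n}" for i
      using *(3) that unfolding map_eq_conv set_upt atLeastLessThanSuc_atLeastAtMost by blast
    then show "\<sigma> = \<tau>"
      using *(1,2) by (metis ext mem_Collect_eq permutes_not_in)
  qed
  have sub: "?f ` {\<sigma>. \<sigma> permutes {1..n}} \<subseteq> permutations_of_set {1..n}"
  proof clarify
    fix \<sigma> assume s: "\<sigma> permutes {1..n}"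
    have "set [1..<Suc n] = {1..n}" by auto
    then show "?f \<sigma> \<in> permutations_of_set {1..n}"
      using permutes_image[OF s] permutes_inj_on[OF s]
      by (intro permutations_of_setI) (simp_all only: set_map distinct_map distinct_upt)
  qed
  \<comment> \<open>Both sets have \<open>fact n\<close> elements, so surjectivity follows from
    injectivity.\<close>
  have "card (?f ` {\<sigma>. \<sigma> permutes {1..n}}) = card (permutations_of_set {1..n})"
    using card_permutations[of "{1..n}" n] by (simp add: card_image[OF inj] del: upt_Suc One_nat_def)
  then show ?thesis
    using inj sub by (intro bij_betw_imageI card_subset_eq) auto
qed

lemma alternating_True_map_upt:
  "alternating True (map \<sigma> [1..<Suc n]) \<longleftrightarrow>
    (\<forall>i \<in> {1..<n}. if odd i then \<sigma> i > \<sigma> (i + 1) else \<sigma> i < \<sigma> (i + 1))"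
proof -
  have shift: "(\<forall>i. Suc i < n \<longrightarrow> P (Suc i)) \<longleftrightarrow> (\<forall>i \<in> {1..<n}. P i)" for P
    by (metis One_nat_def Suc_le_D Suc_le_eq atLeastLessThan_iff zero_less_Suc)
  have "alternating True (map \<sigma> [1..<Suc n]) \<longleftrightarrow> (\<forall>i. Suc i < n \<longrightarrow>
      (if odd (Suc i) then \<sigma> (Suc i) > \<sigma> (Suc i + 1) else \<sigma> (Suc i) < \<sigma> (Suc i + 1)))"
    unfolding alternating_iff_nth by (simp del: upt_Suc)
  then show ?thesis
    unfolding shift[of "\<lambda>i. if odd i then \<sigma> i > \<sigma> (i + 1) else \<sigma> i < \<sigma> (i + 1)"] .
qed

lemma dominated_map_upt: "dominated (map \<sigma> [1..<Suc n]) = mmp1000 n \<sigma>"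
proof -
  have "dominated (map \<sigma> [1..<Suc n]) =
      (\<Sum>i<n. of_bool (\<exists>j<n. i < j \<and> \<sigma> (Suc i) < \<sigma> (Suc j)))"
    unfolding dominated_eq_sum by (simp del: upt_Suc cong: conj_cong)
  also have "\<dots> = (\<Sum>i<n. of_bool (\<exists>j\<in>{1..n}. Suc i < j \<and> \<sigma> (Suc i) < \<sigma> j))"
  proof -
    have "(\<exists>j<n. i < j \<and> \<sigma> (Suc i) < \<sigma> (Suc j)) \<longleftrightarrow>
        (\<exists>j\<in>Suc ` {..<n}. Suc i < j \<and> \<sigma> (Suc i) < \<sigma> j)" for i
      by (auto simp del: image_Suc_lessThan)
    then show ?thesis by (simp add: image_Suc_lessThan)
  qed
  also have "\<dots> = (\<Sum>i\<in>{1..n}. of_bool (\<exists>j\<in>{1..n}. i < j \<and> \<sigma> i < \<sigma> j))"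
    by (simp add: sum.atLeast1_atMost_eq)
  also have "\<dots> = mmp1000 n \<sigma>"
    by (simp add: mmp1000_def sum_of_bool_eq Int_def)
  finally show ?thesis .
qed

lemma DU_count_eq: "DU_count n m = alt_dom_count True n m"
proof -
  let ?f = "\<lambda>\<sigma> :: nat \<Rightarrow> nat. map \<sigma> [1..<Suc n]"
  have "bij_betw ?f {\<sigma> \<in> {\<sigma>. \<sigma> permutes {1..n}}. alternating True (?f \<sigma>) \<and> dominated (?f \<sigma>) = m}
    {xs \<in> permutations_of_set {1..n}. alternating True xs \<and> dominated xs = m}"
    using bij_betw_permutes_lists[of n] unfolding bij_betw_def
    by (auto simp del: upt_Suc intro: inj_on_subset)
  then show ?thesis
    unfolding DU_count_def alt_dom_count_def alt_lists_dom_def alt_lists_def DU_def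
    by (simp add: bij_betw_same_card[symmetric] dominated_map_upt alternating_True_map_upt
        del: upt_Suc One_nat_def)
qed

section \<open>The polynomials for even and odd length\<close>

lemma double_fact_even: "double_fact (2 * n) = dfact 1 n"
  by (simp add: double_fact_def dfact_def prod.atLeast1_atMost_eq)

lemma double_fact_odd: "n \<ge> 1 \<Longrightarrow> double_fact (2 * n - 1) = dfact 0 n"
  by (simp add: double_fact_def dfact_def prod.atLeast1_atMost_eq)

theorem theorem3p5:
  shows "\<exists>(r :: nat \<Rightarrow> rat poly) (s :: nat \<Rightarrow> rat poly). \<forall>k :: nat.
    (\<forall>n \<ge> k + 1. of_nat (C_eq n (n - 1 + k)) =
        poly (r k) (of_nat n) * of_nat (double_fact (2 * n - 2))) \<and>
    (\<forall>n \<ge> k + 1. of_nat (D_eq n (n + k)) =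
        poly (s k) (of_nat n) * of_nat (double_fact (2 * n - 1)))"
proof -
  obtain r :: "nat \<Rightarrow> rat poly" where r: "\<And>k n. k \<le> n \<Longrightarrow>
      of_nat (alt_dom_count True (2 * n + 1 + 1) (n + k)) = poly (r k) (of_nat n) * of_nat (dfact 1 n)"
    using alt_dom_count_True_poly[of 1] by (metis order_refl)
  obtain s :: "nat \<Rightarrow> rat poly" where s: "\<And>k n. k \<le> n \<Longrightarrow>
      of_nat (alt_dom_count True (2 * n + 0 + 1) (n + k)) = poly (s k) (of_nat n) * of_nat (dfact 0 n)"
    using alt_dom_count_True_poly[of 0] by (metis zero_le)
  \<comment> \<open>Even length \<open>2 * n\<close> is \<open>2 * (n - 1) + 1 + 1\<close>, so
    \<open>r k\<close> is applied at \<open>n - 1\<close>, and \<open>dfact 1 (n - 1)\<close> is the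
    required double factorial. Odd length \<open>2 * n + 1\<close> needs no such shift.\<close>
  define r' where "r' k = pcompose (r k) [:-1, 1:]" for k
  have "of_nat (C_eq n (n - 1 + k)) = poly (r' k) (of_nat n) * of_nat (double_fact (2 * n - 2))"
    if "n \<ge> k + 1" for n k
  proof -
    obtain n' where n': "n = Suc n'" "k \<le> n'" using \<open>n \<ge> k + 1\<close> by (cases n) auto
    then show ?thesis
      using r[OF n'(2)] double_fact_even[of n'] by (simp add: DU_count_eq poly_pcompose r'_def)
  qed
  moreover have "of_nat (D_eq n (n + k)) = poly (s k) (of_nat n) * of_nat (double_fact (2 * n - 1))"
    if "n \<ge> k + 1" for n k
    using s[of k n] that by (simp add: DU_count_eq double_fact_odd del: One_nat_def)
  ultimately show ?thesis by metis
qed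

end
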